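(* Let $(\Omega,\Sigma,\mu)$ be a finite measure space, $n\in\mathbb N$ with $n\ge 1$, and let $f\colon\mathbb R^n\times\Omega\to\mathbb R$ be a function such that $f(\cdot,\omega)\in H_n$ (i.e. $f(\cdot,\omega)$ is continuous and positively homogeneous) for every $\omega\in\Omega$, and $f(\boldsymbol{s},\cdot)$ is $\mu$-integrable for every $\boldsymbol{s}\in\mathbb R^n$. Define $F\colon\mathbb R^n\to\mathbb R$ by $F(\boldsymbol{s})=\int_\Omega f(\boldsymbol{s},\omega)\,d\mu(\omega)$. Let $X$ be a real Banach lattice, $\boldsymbol{x}=(x_1,\dots,x_n)\in X^n$, and let $\Phi\colon H_n\to X$ be Krivine's function calculus associated with $\boldsymbol{x}$. For $\omega\in\Omega$ write $f(\boldsymbol{x},\omega):=\Phi\bigl(f(\cdot,\omega)\bigr)\in X$. Suppose that $F$ is continuous (so that $F\in H_n$ and $F(\boldsymbol{x}):=\Phi(F)\in X$ is defined) and that the function $M\colon\Omega\to\mathbb R$, $M(\omega):=\sup_{\boldsymbol{s}\in S_\infty^n}\lvert f(\boldsymbol{s},\omega)\rvert$, is $\mu$-integrable. Then the function $\omega\in\Omega\mapsto f(\boldsymbol{x},\omega)\in X$ is Bochner integrable and $$F(\boldsymbol{x})=\int_\Omega f(\boldsymbol{x},\omega)\,d\mu(\omega),$$ where the right hand side is a Bochner integral.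
   Context: A function $G\colon\mathbb R^n\to\mathbb R$ is positively homogeneous if $G(\lambda t_1,\dots,\lambda t_n)=\lambda G(t_1,\dots,t_n)$ for all $t_1,\dots,t_n\in\mathbb R$ and all $\lambda\ge 0$. $H_n$ denotes the vector lattice (with pointwise operations and order) of all continuous positively homogeneous functions $\mathbb R^n\to\mathbb R$. $S_\infty^n=\{(t_1,\dots,t_n)\in\mathbb R^n : \max_{i}\lvert t_i\rvert=1\}$ is the unit sphere of $\ell_\infty^n$; restriction to $S_\infty^n$ is a lattice isomorphism of $H_n$ onto $C(S_\infty^n)$, and $H_n$ is identified with $C(S_\infty^n)$ (with the sup norm) in this way. $\pi_i\in H_n$ is the $i$-th coordinate projection. Krivine's function calculus: given a real Banach lattice $X$ and $\boldsymbol{x}=(x_1,\dots,x_n)\in X^n$, there is a unique lattice homomorphism (linear map preserving lattice operations) $\Phi\colon H_n\to X$ with $\Phi(\pi_i)=x_i$ for $i=1,\dots,n$; one writes $G(\boldsymbol{x})=\Phi(G)$ for $G\in H_n$. Concretely: let $e\in X_+$ be such that $x_1,\dots,x_n$ belong to the principal order ideal $I_e$ of $e$ (e.g. $e=\lvert x_1\rvert\vee\dots\vee\lvert x_n\rvert$). By Kakutani's theorem, $I_e$ with the norm $\lVert x\rVert_e=\inf\{\lambda>0 : \lvert x\rvert\le\lambda e\}$ is lattice isometric to $C(K)$ for some compact Hausdorff $K$; viewing $x_1,\dots,x_n$ as elements of $C(K)$, $\Phi(G)$ is the element of $I_e\subseteq X$ corresponding to the function $k\mapsto G(x_1(k),\dots,x_n(k))$.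 The result does not depend on the choice of $e$. Bochner integral: a function $g\colon\Omega\to X$ is measurable if there is a sequence $(g_j)$ of simple functions $\Omega\to X$ with $\lim_j\lVert g_j(\omega)-g(\omega)\rVert=0$ for almost every $\omega$. If in addition $\int\lVert g_j(\omega)-g(\omega)\rVert\,d\mu(\omega)\to 0$ for such a sequence, then $g$ is Bochner integrable and $\int_A g\,d\mu=\lim_j\int_A g_j\,d\mu$ for every measurable set $A$. *)

theory Defs
  imports "HOL-Analysis.Analysis" "HOL-Library.Lattice_Algebras"
begin

text \<open>In \<^class>\<open>lattice_ab_group_add_abs\<close> the modulus is \<open>\<bar>x\<bar> = sup x (- x)\<close>.\<close>

class banach_lattice = banach + ordered_real_vector + lattice_ab_group_add_abs +
  assumes norm_mono_abs: "\<bar>x\<bar> \<le> \<bar>y\<bar> \<Longrightarrow> norm x \<le> norm y"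

definition pos_homogeneous :: "(real ^ 'n \<Rightarrow> real) \<Rightarrow> bool" where
  "pos_homogeneous G \<longleftrightarrow> (\<forall>t. \<forall>c\<ge>0. G (c *\<^sub>R t) = c * G t)"

definition Hn :: "(real ^ 'n \<Rightarrow> real) set" where
  "Hn = {G. continuous_on UNIV G \<and> pos_homogeneous G}"

definition sphere_inf :: "(real ^ 'n) set" where
  "sphere_inf = {t. (MAX i. \<bar>t $ i\<bar>) = 1}"

text \<open>
  Linear maps on \<^const>\<open>Hn\<close> preserving the lattice operations. A map is represented by a total
  function on \<open>real ^ 'n \<Rightarrow> real\<close> whose values outside \<^const>\<open>Hn\<close> are irrelevant.
\<close>

definition lattice_hom_Hn :: "((real ^ 'n \<Rightarrow> real) \<Rightarrow> 'x::banach_lattice) \<Rightarrow> bool" where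
  "lattice_hom_Hn \<Phi> \<longleftrightarrow>
     (\<forall>G\<in>Hn. \<forall>H\<in>Hn. \<Phi> (\<lambda>t. G t + H t) = \<Phi> G + \<Phi> H) \<and>
     (\<forall>G\<in>Hn. \<forall>c. \<Phi> (\<lambda>t. c * G t) = c *\<^sub>R \<Phi> G) \<and>
     (\<forall>G\<in>Hn. \<forall>H\<in>Hn. \<Phi> (\<lambda>t. max (G t) (H t)) = sup (\<Phi> G) (\<Phi> H)) \<and>
     (\<forall>G\<in>Hn. \<forall>H\<in>Hn. \<Phi> (\<lambda>t. min (G t) (H t)) = inf (\<Phi> G) (\<Phi> H))"

text \<open>
  \<open>\<Phi>\<close> is Krivine's function calculus for \<open>x\<close>. By Krivine's theorem such a \<open>\<Phi>\<close> exists and is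
  unique on \<^const>\<open>Hn\<close>.
\<close>

definition krivine_calculus ::
    "'x::banach_lattice ^ 'n \<Rightarrow> ((real ^ 'n \<Rightarrow> real) \<Rightarrow> 'x) \<Rightarrow> bool" where
  "krivine_calculus x \<Phi> \<longleftrightarrow> lattice_hom_Hn \<Phi> \<and> (\<forall>i. \<Phi> (\<lambda>t. t $ i) = x $ i)"

text \<open>
  The Bochner integral of HOL-Analysis requires a second countable codomain, hence the following
  definitions for arbitrary normed spaces. On a finite measure space
  \<^const>\<open>Bochner_Integration.simple_bochner_integrable\<close> is the same as \<^const>\<open>simple_function\<close>. The function
  \<open>\<omega> \<mapsto> norm (s j \<omega> - g \<omega>)\<close> is an almost everywhere limit of simple functions and thus measurable
  only with respect to the completion of \<open>M\<close>; for such functions the nonnegative integral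
  over \<open>M\<close> is the integral over the completion (\<open>nn_integral_completion\<close>).
\<close>

definition bochner_approx ::
    "'a measure \<Rightarrow> ('a \<Rightarrow> 'b::real_normed_vector) \<Rightarrow> (nat \<Rightarrow> 'a \<Rightarrow> 'b) \<Rightarrow> bool" where
  "bochner_approx M g s \<longleftrightarrow>
     (\<forall>j. Bochner_Integration.simple_bochner_integrable M (s j)) \<and>
     (AE \<omega> in M. (\<lambda>j. norm (s j \<omega> - g \<omega>)) \<longlonglongrightarrow> 0) \<and>
     (\<lambda>j. \<integral>\<^sup>+\<omega>. ennreal (norm (s j \<omega> - g \<omega>)) \<partial>M) \<longlonglongrightarrow> 0"

definition bochner_integrable :: "'a measure \<Rightarrow> ('a \<Rightarrow> 'b::real_normed_vector) \<Rightarrow> bool" where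
  "bochner_integrable M g \<longleftrightarrow> (\<exists>s. bochner_approx M g s)"

definition bochner_integral :: "'a measure \<Rightarrow> ('a \<Rightarrow> 'b::real_normed_vector) \<Rightarrow> 'b" where
  "bochner_integral M g =
     (THE v. \<exists>s. bochner_approx M g s \<and> (\<lambda>j. Bochner_Integration.simple_bochner_integral M (s j)) \<longlonglongrightarrow> v)"

end

theory Submission
  imports Defs
begin

text \<open>
  A partition of unity of mesh \<open>1 / (j + 1)\<close> on the Euclidean unit sphere, with nodes \<open>s\<close> in a finite
  set \<open>K j\<close>, extended homogeneously to functions \<open>\<phi> j s\<close> in \<^const>\<open>Hn\<close>, gives finite rank operators
  \<open>P j G = (\<Sum>s\<in>K j. G s * \<phi> j s)\<close> with \<open>P j G \<longrightarrow> G\<close> uniformly on the sphere for \<open>G \<in> Hn\<close>. Since a lattice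
  homomorphism \<open>\<Phi>\<close> is bounded by \<open>norm (\<Phi> norm)\<close>, the functions
  \<open>\<omega> \<mapsto> \<Phi> (P j (f(\<cdot>, \<omega>))) = (\<Sum>s\<in>K j. f(s, \<omega>) \<Phi> (\<phi> j s))\<close> converge to \<open>\<Phi> (f(\<cdot>, \<omega>))\<close>, dominated by a
  multiple of \<open>M\<close>, while their integrals \<open>(\<Sum>s\<in>K j. F s \<Phi> (\<phi> j s)) = \<Phi> (P j F)\<close> converge to \<open>\<Phi> F\<close>. The
  coefficients \<open>f(s, \<cdot>)\<close> are scalar integrable functions and are approximated by simple functions.
\<close>

subsection \<open>Positively homogeneous functions\<close>

lemma HnD_continuous: "G \<in> Hn \<Longrightarrow> continuous_on UNIV G"
  by (simp add: Hn_def)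

lemma HnD_scale: "G \<in> Hn \<Longrightarrow> 0 \<le> c \<Longrightarrow> G (c *\<^sub>R t) = c * G t"
  by (simp add: Hn_def pos_homogeneous_def)

lemma Hn_zero: "(\<lambda>t. 0) \<in> Hn"
  by (simp add: Hn_def pos_homogeneous_def)

lemma Hn_norm: "norm \<in> Hn"
  by (simp add: Hn_def pos_homogeneous_def continuous_on_norm_id)

lemma Hn_add: "G \<in> Hn \<Longrightarrow> H \<in> Hn \<Longrightarrow> (\<lambda>t. G t + H t) \<in> Hn"
  by (auto simp: Hn_def pos_homogeneous_def algebra_simps intro: continuous_on_add)

lemma Hn_scale: "G \<in> Hn \<Longrightarrow> (\<lambda>t. c * G t) \<in> Hn"
  by (auto simp: Hn_def pos_homogeneous_def algebra_simps intro: continuous_on_mult_left)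

lemma Hn_sum: "(\<And>k. k \<in> K \<Longrightarrow> G k \<in> Hn) \<Longrightarrow> (\<lambda>t. \<Sum>k\<in>K. G k t) \<in> Hn"
  by (induction K rule: infinite_finite_induct) (auto intro: Hn_zero Hn_add)

lemma Hn_diff: "G \<in> Hn \<Longrightarrow> H \<in> Hn \<Longrightarrow> (\<lambda>t. G t - H t) \<in> Hn"
  using Hn_add[of G "\<lambda>t. -1 * H t"] Hn_scale[of H "-1"] by simp

lemma Hn_at_zero: "G \<in> Hn \<Longrightarrow> G 0 = 0"
  using HnD_scale[of G 0 0] by simp

lemma Hn_bound_from_sphere:
  assumes "G \<in> Hn" and "\<And>s. norm s = 1 \<Longrightarrow> \<bar>G s\<bar> \<le> c"
  shows "\<bar>G t\<bar> \<le> c * norm t"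
proof (cases "t = 0")
  case True
  then show ?thesis using Hn_at_zero[OF assms(1)] by simp
next
  case False
  have "G t = norm t * G (t /\<^sub>R norm t)"
    using False HnD_scale[OF assms(1), of "norm t" "t /\<^sub>R norm t"] by simp
  moreover have "\<bar>G (t /\<^sub>R norm t)\<bar> \<le> c"
    using False by (intro assms(2)) simp
  ultimately show ?thesis
    by (metis abs_mult abs_norm_cancel mult.commute mult_right_mono norm_ge_zero)
qed

text \<open>Compactness: on \<open>sphere_inf\<close> every coordinate has modulus at most 1, so the
  set lies in a closed ball whose radius is the dimension. Boundedness is what makes the real-valued
  \<open>SUP\<close> over \<open>sphere_inf\<close> a genuine upper bound.\<close>

lemma bdd_above_sphere_inf:
  assumes "continuous_on UNIV (G :: real ^ 'n \<Rightarrow> real)"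
  shows "bdd_above ((\<lambda>s. \<bar>G s\<bar>) ` sphere_inf)"
proof -
  have "sphere_inf \<subseteq> cball (0 :: real ^ 'n) (real CARD('n))"
  proof
    fix t :: "real ^ 'n" assume t: "t \<in> sphere_inf"
    have "\<bar>t $ i\<bar> \<le> 1" for i
      using t Max_ge[of "range (\<lambda>i. \<bar>t $ i\<bar>)" "\<bar>t $ i\<bar>"] by (simp add: sphere_inf_def)
    then have "(\<Sum>i\<in>UNIV. \<bar>t $ i\<bar>) \<le> (\<Sum>i\<in>(UNIV::'n set). 1)"
      by (intro sum_mono)
    then show "t \<in> cball 0 (real CARD('n))"
      using norm_le_l1_cart[of t] by simp
  qed
  moreover have "compact ((\<lambda>s. \<bar>G s\<bar>) ` cball 0 (real CARD('n)))"
    by (intro compact_continuous_image continuous_intros continuous_on_subset[OF assms]) auto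
  ultimately show ?thesis
    using bdd_above_mono[OF bounded_imp_bdd_above[OF compact_imp_bounded]] image_mono by metis
qed

text \<open>Dividing \<open>t\<close> by its max-norm \<open>m\<close> lands in
  \<open>sphere_inf\<close>, and \<open>m \<le> norm t\<close>. The bound carries the domination
  hypothesis, stated on the max-norm sphere, over to the Euclidean sphere on which the partition of
  unity lives.\<close>

lemma Hn_bound_from_sphere_inf:
  assumes G: "G \<in> Hn"
  shows "\<bar>G t\<bar> \<le> (SUP s\<in>sphere_inf. \<bar>G s\<bar>) * norm t"
proof (cases "t = 0")
  case True
  then show ?thesis using Hn_at_zero[OF G] by simp
next
  case False
  let ?S = "SUP s\<in>sphere_inf. \<bar>G s\<bar>"
  define m where "m = (MAX i. \<bar>t $ i\<bar>)"
  have ge: "\<bar>t $ i\<bar> \<le> m" for i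
    unfolding m_def by (intro Max_ge) auto
  have "m \<in> range (\<lambda>i. \<bar>t $ i\<bar>)"
    unfolding m_def by (intro Max_in) auto
  then have m_le: "m \<le> norm t"
    using component_le_norm_cart by auto
  have m_pos: "m > 0"
  proof -
    obtain i where "t $ i \<noteq> 0"
      using False by (auto simp: vec_eq_iff)
    then show ?thesis using ge[of i] by linarith
  qed
  have "(MAX i. \<bar>(t /\<^sub>R m) $ i\<bar>) = (MAX i. \<bar>t $ i\<bar> / m)"
    using m_pos by (simp add: abs_mult field_simps)
  also have "\<dots> = m / m"
    using mono_Max_commute[of "\<lambda>y. y / m" "range (\<lambda>i. \<bar>t $ i\<bar>)"] m_pos
    by (simp add: m_def monoI divide_right_mono image_image)
  finally have "t /\<^sub>R m \<in> sphere_inf"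
    using m_pos by (simp add: sphere_inf_def)
  then have le: "\<bar>G (t /\<^sub>R m)\<bar> \<le> ?S"
    by (rule cSUP_upper[OF _ bdd_above_sphere_inf[OF HnD_continuous[OF G]]])
  have "\<bar>G t\<bar> = m * \<bar>G (t /\<^sub>R m)\<bar>"
    using m_pos HnD_scale[OF G, of m "t /\<^sub>R m"] by (simp add: abs_mult)
  also have "\<dots> \<le> norm t * ?S"
    using m_le m_pos le by (intro mult_mono) auto
  finally show ?thesis by (simp add: mult.commute)
qed

text \<open>By compactness finitely many balls of radius \<open>d\<close> around nodes cover the
  sphere. Bumps supported in these balls, divided by their sum, form a partition of unity on the
  sphere, which is then extended with degree one.\<close>

lemma homogeneous_partition:
  assumes d: "d > 0"
  obtains K :: "(real ^ 'n) set" and \<phi> where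
    "finite K" "\<And>s. s \<in> K \<Longrightarrow> norm s = 1" "\<And>s. s \<in> K \<Longrightarrow> \<phi> s \<in> Hn"
    "\<And>s t. 0 \<le> \<phi> s t" "\<And>t. (\<Sum>s\<in>K. \<phi> s t) = norm t"
    "\<And>s t. norm t = 1 \<Longrightarrow> \<phi> s t \<noteq> 0 \<Longrightarrow> dist t s < d"
proof -
  have cover: "sphere 0 1 \<subseteq> (\<Union>s\<in>sphere (0 :: real ^ 'n) 1. ball s d)"
    using d by force
  obtain K :: "(real ^ 'n) set" where K: "finite K" "K \<subseteq> sphere 0 1" "sphere 0 1 \<subseteq> (\<Union>s\<in>K. ball s d)"
    by (rule compactE_image[OF compact_sphere open_ball cover])
  \<comment> \<open>On the unit sphere this is the bump \<open>max 0 (d - dist t s)\<close>. Scaling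
    the node to \<open>norm t *\<^sub>R s\<close> makes it positively homogeneous.\<close>
  define w where "w s t = max 0 (d * norm t - norm (t - norm t *\<^sub>R s))" for s t :: "real ^ 'n"
  define W where "W t = (\<Sum>r\<in>K. w r t)" for t
  \<comment> \<open>The quotient \<open>w s t / W t\<close> has degree zero, hence the factor
    \<open>norm t\<close>. At the origin the formula reads 0 / 0, which has the desired value
    0.\<close>
  define \<phi> where "\<phi> s t = norm t * w s t / W t" for s t
  have w_nonneg: "0 \<le> w s t" for s t
    by (simp add: w_def)
  have W_nonneg: "0 \<le> W t" for t
    by (simp add: W_def sum_nonneg w_nonneg)
  have w_scale: "w s (c *\<^sub>R t) = c * w s t" if "c \<ge> 0" for s t c
  proof -
    have "c *\<^sub>R t - norm (c *\<^sub>R t) *\<^sub>R s = c *\<^sub>R (t - norm t *\<^sub>R s)"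
      using that by (simp add: algebra_simps)
    then have "norm (c *\<^sub>R t - norm (c *\<^sub>R t) *\<^sub>R s) = c * norm (t - norm t *\<^sub>R s)"
      using that by simp
    then show ?thesis
      using that by (simp add: w_def max_mult_distrib_left right_diff_distrib mult.left_commute)
  qed
  then have W_scale: "W (c *\<^sub>R t) = c * W t" if "c \<ge> 0" for t c
    using that by (simp add: W_def sum_distrib_left)
  have w_cont: "continuous_on UNIV (w s)" for s
    unfolding w_def by (intro continuous_intros)
  have W_cont: "continuous_on UNIV W"
    unfolding W_def by (intro continuous_intros w_cont)
  have W_pos: "W t > 0" if "t \<noteq> 0" for t
  proof -
    have "t /\<^sub>R norm t \<in> sphere 0 1" using that by simp
    then obtain s where s: "s \<in> K" "t /\<^sub>R norm t \<in> ball s d" using K(3) by blast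
    have "0 < w s (t /\<^sub>R norm t)"
      using s that by (simp add: w_def dist_norm norm_minus_commute)
    also have "\<dots> \<le> W (t /\<^sub>R norm t)"
      unfolding W_def using s K(1) by (intro member_le_sum) (auto simp: w_nonneg)
    also have "\<dots> = inverse (norm t) * W t"
      by (simp add: W_scale)
    finally show ?thesis using that by (simp add: zero_less_mult_iff)
  qed
  have nonneg: "0 \<le> \<phi> s t" for s t
    by (simp add: \<phi>_def w_nonneg W_nonneg)
  have sum_eq: "(\<Sum>s\<in>K. \<phi> s t) = norm t" for t
  proof -
    have "(\<Sum>s\<in>K. \<phi> s t) = norm t * W t / W t"
      unfolding \<phi>_def W_def by (simp add: sum_distrib_left sum_divide_distrib)
    then show ?thesis using W_pos[of t] by (cases "t = 0") auto
  qed
  have \<phi>_le: "\<phi> s t \<le> norm t" if "s \<in> K" for s t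
    using member_le_sum[of s K "\<lambda>s. \<phi> s t"] that K(1) nonneg sum_eq by auto
  have in_Hn: "\<phi> s \<in> Hn" if s: "s \<in> K" for s
  proof -
    have "\<phi> s (c *\<^sub>R t) = c * \<phi> s t" if "c \<ge> 0" for c t
      using that by (cases "c = 0") (auto simp: \<phi>_def w_scale W_scale)
    moreover have "isCont (\<phi> s) t" for t
    proof (cases "t = 0")
      case True
      \<comment> \<open>Since \<open>W\<close> vanishes at the origin, continuity there comes from
        squeezing \<phi> between 0 and the norm.\<close>
      have "((\<lambda>t. \<phi> s t) \<longlongrightarrow> 0) (at 0)"
        by (rule tendsto_sandwich[of "\<lambda>_. 0" _ _ norm])
           (auto simp: nonneg \<phi>_le s intro: tendsto_eq_intros)
      moreover have "\<phi> s 0 = 0" by (simp add: \<phi>_def)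
      ultimately show ?thesis using True by (simp add: isCont_def)
    next
      case False
      have "isCont (w s) t" "isCont W t"
        using w_cont W_cont by (auto simp: continuous_on_eq_continuous_at)
      then show ?thesis
        unfolding \<phi>_def using W_pos[OF False] by (intro continuous_intros) auto
    qed
    ultimately show ?thesis
      by (auto simp: Hn_def pos_homogeneous_def intro: continuous_at_imp_continuous_on)
  qed
  show ?thesis
  proof (rule that[OF K(1) _ in_Hn nonneg sum_eq])
    show "norm s = 1" if "s \<in> K" for s using that K(2) by auto
    show "dist t s < d" if "norm t = 1" "\<phi> s t \<noteq> 0" for s t
      using that by (auto simp: \<phi>_def w_def dist_norm max_def split: if_splits)
  qed
qed

text \<open>The weights sum to 1, so the error is a convex combination of the differences
  \<open>G s - G t\<close>, and only nodes of nonzero weight contribute.\<close>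

lemma partition_approximation:
  fixes G :: "real ^ 'n \<Rightarrow> real"
  assumes nonneg: "\<And>s. s \<in> K \<Longrightarrow> 0 \<le> \<phi> s" and sum: "(\<Sum>s\<in>K. \<phi> s) = 1"
    and close: "\<And>s. s \<in> K \<Longrightarrow> \<phi> s \<noteq> 0 \<Longrightarrow> \<bar>G s - G t\<bar> \<le> \<epsilon>"
  shows "\<bar>(\<Sum>s\<in>K. G s * \<phi> s) - G t\<bar> \<le> \<epsilon>"
proof -
  have "(\<Sum>s\<in>K. G s * \<phi> s) - G t = (\<Sum>s\<in>K. G s * \<phi> s) - G t * (\<Sum>s\<in>K. \<phi> s)"
    by (simp add: sum)
  also have "\<dots> = (\<Sum>s\<in>K. (G s - G t) * \<phi> s)"
    by (simp add: sum_distrib_left left_diff_distrib sum_subtractf)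
  finally have "\<bar>(\<Sum>s\<in>K. G s * \<phi> s) - G t\<bar> \<le> (\<Sum>s\<in>K. \<bar>(G s - G t) * \<phi> s\<bar>)"
    by (metis sum_abs)
  also have "\<dots> \<le> (\<Sum>s\<in>K. \<epsilon> * \<phi> s)"
    using nonneg close by (intro sum_mono) (force simp: abs_mult intro: mult_right_mono)
  also have "\<dots> = \<epsilon>"
    by (simp add: sum flip: sum_distrib_left)
  finally show ?thesis .
qed

subsection \<open>Lattice homomorphisms on the positively homogeneous functions\<close>

lemma lattice_hom_Hn_add:
  "lattice_hom_Hn \<Phi> \<Longrightarrow> G \<in> Hn \<Longrightarrow> H \<in> Hn \<Longrightarrow> \<Phi> (\<lambda>t. G t + H t) = \<Phi> G + \<Phi> H"
  by (simp add: lattice_hom_Hn_def)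

lemma lattice_hom_Hn_scale:
  "lattice_hom_Hn \<Phi> \<Longrightarrow> G \<in> Hn \<Longrightarrow> \<Phi> (\<lambda>t. c * G t) = c *\<^sub>R \<Phi> G"
  by (simp add: lattice_hom_Hn_def)

lemma lattice_hom_Hn_diff:
  assumes "lattice_hom_Hn \<Phi>" "G \<in> Hn" "H \<in> Hn"
  shows "\<Phi> (\<lambda>t. G t - H t) = \<Phi> G - \<Phi> H"
  using lattice_hom_Hn_add[OF assms(1,2) Hn_scale[OF assms(3)], of "-1"]
    lattice_hom_Hn_scale[OF assms(1,3), of "-1"] by simp

lemma lattice_hom_Hn_sum:
  assumes "lattice_hom_Hn \<Phi>" "\<And>k. k \<in> K \<Longrightarrow> G k \<in> Hn"
  shows "\<Phi> (\<lambda>t. \<Sum>k\<in>K. c k * G k t) = (\<Sum>k\<in>K. c k *\<^sub>R \<Phi> (G k))"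
proof -
  have zero: "\<Phi> (\<lambda>t. 0) = 0"
    using lattice_hom_Hn_scale[OF assms(1) Hn_zero, of 0] by simp
  show ?thesis
    using assms(2)
    by (induction K rule: infinite_finite_induct)
       (simp_all add: zero lattice_hom_Hn_add[OF assms(1)] lattice_hom_Hn_scale[OF assms(1)]
         Hn_scale Hn_sum)
qed

lemma lattice_hom_Hn_mono:
  assumes "lattice_hom_Hn \<Phi>" "G \<in> Hn" "H \<in> Hn" "\<And>t. G t \<le> H t"
  shows "\<Phi> G \<le> \<Phi> H"
proof -
  have "\<Phi> (\<lambda>t. max (G t) (H t)) = sup (\<Phi> G) (\<Phi> H)"
    using assms(1-3) by (simp add: lattice_hom_Hn_def)
  moreover have "(\<lambda>t. max (G t) (H t)) = H"
    using assms(4) by (auto simp: max_def)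
  ultimately show ?thesis by (metis sup_ge1)
qed

text \<open>A lattice homomorphism is monotone, so the pointwise bound of
  \<open>\<bar>G\<bar>\<close> by \<open>c\<close> times the Euclidean norm passes to the moduli of
  the images, and the lattice norm respects moduli. Thus \<Phi> is Lipschitz for the sup norm on the
  Euclidean sphere.\<close>

lemma norm_lattice_hom_Hn_le:
  assumes hom: "lattice_hom_Hn \<Phi>" and G: "G \<in> Hn" and le: "\<And>t. norm t = 1 \<Longrightarrow> \<bar>G t\<bar> \<le> c"
    and c: "0 \<le> c"
  shows "norm (\<Phi> G) \<le> c * norm (\<Phi> norm)"
proof -
  have bound: "\<bar>G t\<bar> \<le> c * norm t" for t
    by (rule Hn_bound_from_sphere[OF G le])
  have N: "(\<lambda>t. c * norm t) \<in> Hn"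
    by (intro Hn_scale Hn_norm)
  have "\<Phi> G \<le> \<Phi> (\<lambda>t. c * norm t)"
    using bound by (intro lattice_hom_Hn_mono[OF hom G N]) (meson abs_le_D1)
  moreover have "\<Phi> (\<lambda>t. -1 * G t) \<le> \<Phi> (\<lambda>t. c * norm t)"
    using bound by (intro lattice_hom_Hn_mono[OF hom Hn_scale[OF G] N]) (simp add: abs_le_iff)
  ultimately have "\<bar>\<Phi> G\<bar> \<le> c *\<^sub>R \<Phi> norm"
    unfolding lattice_hom_Hn_scale[OF hom G] lattice_hom_Hn_scale[OF hom Hn_norm]
    by (simp add: abs_le_iff)
  also have "\<dots> \<le> \<bar>c *\<^sub>R \<Phi> norm\<bar>"
    by (rule abs_ge_self)
  finally show ?thesis
    using norm_mono_abs[of "\<Phi> G" "c *\<^sub>R \<Phi> norm"] c by simp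
qed

subsection \<open>Bochner integrals\<close>

lemma ennreal_tendsto_zero_le:
  fixes f g :: "nat \<Rightarrow> ennreal"
  assumes "g \<longlonglongrightarrow> 0" "\<And>j. f j \<le> g j"
  shows "f \<longlonglongrightarrow> 0"
  using assms by (intro tendsto_sandwich[OF _ _ tendsto_const assms(1)]) auto

lemma simple_bochner_integrable_sum:
  "(\<And>k. k \<in> K \<Longrightarrow> Bochner_Integration.simple_bochner_integrable M (f k)) \<Longrightarrow>
    Bochner_Integration.simple_bochner_integrable M (\<lambda>x. \<Sum>k\<in>K. f k x)"
proof (induction K rule: infinite_finite_induct)
  case (insert k K)
  then show ?case
    by (simp add: simple_bochner_integrable_compose2[where p="(+)"])
qed (auto intro: simple_bochner_integrable.intros)

lemma simple_bochner_integral_sum: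
  "(\<And>k. k \<in> K \<Longrightarrow> Bochner_Integration.simple_bochner_integrable M (f k)) \<Longrightarrow>
    Bochner_Integration.simple_bochner_integral M (\<lambda>x. \<Sum>k\<in>K. f k x) = (\<Sum>k\<in>K. Bochner_Integration.simple_bochner_integral M (f k))"
proof (induction K rule: infinite_finite_induct)
  case (insert k K)
  then show ?case
    by (simp add: simple_bochner_integral_add simple_bochner_integrable_sum)
qed (auto simp: simple_bochner_integral_def intro!: sum.neutral)

lemma simple_bochner_integrable_diff:
  "Bochner_Integration.simple_bochner_integrable M f \<Longrightarrow> Bochner_Integration.simple_bochner_integrable M g \<Longrightarrow>
    Bochner_Integration.simple_bochner_integrable M (\<lambda>x. f x - g x)"
  by (rule simple_bochner_integrable_compose2[where p="(-)"]) auto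

lemma simple_bochner_integrable_norm:
  "Bochner_Integration.simple_bochner_integrable M f \<Longrightarrow> Bochner_Integration.simple_bochner_integrable M (\<lambda>x. norm (f x))"
  by (rule simple_bochner_integrable_compose2[where p="\<lambda>x y. norm x"]) auto

lemma simple_bochner_integrable_scaleR:
  fixes f :: "'a \<Rightarrow> real"
  shows "Bochner_Integration.simple_bochner_integrable M f \<Longrightarrow> Bochner_Integration.simple_bochner_integrable M (\<lambda>x. f x *\<^sub>R a)"
  by (rule simple_bochner_integrable_compose2[where p="\<lambda>x y. x *\<^sub>R a"]) auto

lemma ennreal_norm_simple_bochner_integral_le:
  assumes "Bochner_Integration.simple_bochner_integrable M f"
  shows "ennreal (norm (Bochner_Integration.simple_bochner_integral M f)) \<le> (\<integral>\<^sup>+x. ennreal (norm (f x)) \<partial>M)"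
  using simple_bochner_integral_norm_bound[OF assms]
  by (simp add: simple_bochner_integrable_norm[OF assms] ennreal_leI
      flip: simple_bochner_integral_eq_nn_integral)

text \<open>The distance to \<open>g\<close> agrees almost everywhere with the limit over
  \<open>i\<close> of the measurable distances from \<open>s j\<close> to \<open>s i\<close>. Taking
  \<open>liminf\<close> gives a function that is measurable on the whole space, also at points where
  the sequence does not converge.\<close>

lemma bochner_approx_measurable_distance:
  assumes approx: "bochner_approx M g s"
  obtains h where "\<And>j. h j \<in> borel_measurable M"
    "AE x in M. \<forall>j. ennreal (norm (s j x - g x)) = h j x"
proof
  have s: "Bochner_Integration.simple_bochner_integrable M (s j)" for j
    using approx by (simp add: bochner_approx_def)
  define h where "h j x = liminf (\<lambda>i. ennreal (norm (s j x - s i x)))" for j x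
  have "(\<lambda>x. norm (s j x - s i x)) \<in> borel_measurable M" for i j
    using simple_bochner_integrable_norm[OF simple_bochner_integrable_diff[OF s s]]
    by (auto intro: borel_measurable_simple_function elim: simple_bochner_integrable.cases)
  then show "h j \<in> borel_measurable M" for j
    unfolding h_def[abs_def] by (intro borel_measurable_liminf) simp
  have "AE x in M. (\<lambda>j. norm (s j x - g x)) \<longlonglongrightarrow> 0"
    using approx by (simp add: bochner_approx_def)
  then show "AE x in M. \<forall>j. ennreal (norm (s j x - g x)) = h j x"
  proof eventually_elim
    case (elim x)
    then have "(\<lambda>i. s i x) \<longlonglongrightarrow> g x"
      by (simp add: tendsto_norm_zero_iff LIM_zero_iff)
    then have "(\<lambda>i. ennreal (norm (s j x - s i x))) \<longlonglongrightarrow> ennreal (norm (s j x - g x))" for j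
      by (intro tendsto_intros)
    then show ?case
      unfolding h_def by (metis lim_imp_Liminf sequentially_bot)
  qed
qed

text \<open>The triangle inequality through \<open>g\<close>. The measurable versions
  \<open>h\<close> and \<open>k\<close> of the two distances allow the integral of the sum to be
  split.\<close>

lemma bochner_approx_integral_diff_le:
  assumes s: "bochner_approx M g s" and t: "bochner_approx M g t"
  shows "ennreal (norm (Bochner_Integration.simple_bochner_integral M (s j) - Bochner_Integration.simple_bochner_integral M (t j)))
    \<le> (\<integral>\<^sup>+x. ennreal (norm (s j x - g x)) \<partial>M) + (\<integral>\<^sup>+x. ennreal (norm (t j x - g x)) \<partial>M)"
proof -
  have simple: "Bochner_Integration.simple_bochner_integrable M (s j)" "Bochner_Integration.simple_bochner_integrable M (t j)"
    using s t by (simp_all add: bochner_approx_def)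
  obtain h where h: "\<And>j. h j \<in> borel_measurable M"
    "AE x in M. \<forall>j. ennreal (norm (s j x - g x)) = h j x"
    using bochner_approx_measurable_distance[OF s] by blast
  obtain k where k: "\<And>j. k j \<in> borel_measurable M"
    "AE x in M. \<forall>j. ennreal (norm (t j x - g x)) = k j x"
    using bochner_approx_measurable_distance[OF t] by blast
  have "ennreal (norm (Bochner_Integration.simple_bochner_integral M (s j) - Bochner_Integration.simple_bochner_integral M (t j)))
      \<le> (\<integral>\<^sup>+x. ennreal (norm (s j x - t j x)) \<partial>M)"
    using ennreal_norm_simple_bochner_integral_le[OF simple_bochner_integrable_diff[OF simple]]
    by (simp add: simple_bochner_integral_diff[OF simple])
  also have "\<dots> \<le> (\<integral>\<^sup>+x. h j x + k j x \<partial>M)"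
  proof (rule nn_integral_mono_AE)
    show "AE x in M. ennreal (norm (s j x - t j x)) \<le> h j x + k j x"
      using h(2) k(2)
    proof eventually_elim
      case (elim x)
      have "norm (s j x - t j x) \<le> norm (s j x - g x) + norm (t j x - g x)"
        by (metis norm_diff_triangle_le norm_minus_commute order_refl)
      then have "ennreal (norm (s j x - t j x))
          \<le> ennreal (norm (s j x - g x)) + ennreal (norm (t j x - g x))"
        by (simp add: ennreal_leI flip: ennreal_plus)
      then show ?case using elim by simp
    qed
  qed
  also have "\<dots> = (\<integral>\<^sup>+x. h j x \<partial>M) + (\<integral>\<^sup>+x. k j x \<partial>M)"
    using h(1) k(1) by (rule nn_integral_add)
  also have "(\<integral>\<^sup>+x. h j x \<partial>M) = (\<integral>\<^sup>+x. ennreal (norm (s j x - g x)) \<partial>M)"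
    using h(2) by (intro nn_integral_cong_AE) auto
  also have "(\<integral>\<^sup>+x. k j x \<partial>M) = (\<integral>\<^sup>+x. ennreal (norm (t j x - g x)) \<partial>M)"
    using k(2) by (intro nn_integral_cong_AE) auto
  finally show ?thesis .
qed

text \<open>The definite description in \<open>bochner_integral\<close> is justified here: the
  integrals along two approximating sequences differ by a null sequence, so their limits
  agree.\<close>

lemma bochner_integral_eqI:
  assumes s: "bochner_approx M g s" and v: "(\<lambda>j. Bochner_Integration.simple_bochner_integral M (s j)) \<longlonglongrightarrow> v"
  shows "bochner_integral M g = v"
  unfolding bochner_integral_def
proof (rule the_equality)
  fix w
  assume "\<exists>t. bochner_approx M g t \<and> (\<lambda>j. Bochner_Integration.simple_bochner_integral M (t j)) \<longlonglongrightarrow> w"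
  then obtain t where t: "bochner_approx M g t"
    and w: "(\<lambda>j. Bochner_Integration.simple_bochner_integral M (t j)) \<longlonglongrightarrow> w"
    by blast
  let ?d = "\<lambda>j. Bochner_Integration.simple_bochner_integral M (s j) - Bochner_Integration.simple_bochner_integral M (t j)"
  have "(\<lambda>j. (\<integral>\<^sup>+x. ennreal (norm (s j x - g x)) \<partial>M) + (\<integral>\<^sup>+x. ennreal (norm (t j x - g x)) \<partial>M)) \<longlonglongrightarrow> 0"
    using s t unfolding bochner_approx_def by (auto intro: tendsto_eq_intros)
  then have "(\<lambda>j. ennreal (norm (?d j))) \<longlonglongrightarrow> 0"
    by (rule ennreal_tendsto_zero_le) (rule bochner_approx_integral_diff_le[OF s t])
  then have "(\<lambda>j. norm (?d j)) \<longlonglongrightarrow> 0"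
    by (simp add: ennreal_tendsto_0_iff)
  then have "?d \<longlonglongrightarrow> 0"
    by (rule tendsto_norm_zero_cancel)
  moreover have "?d \<longlonglongrightarrow> v - w"
    by (intro tendsto_diff v w)
  ultimately show "w = v"
    using LIMSEQ_unique[of ?d 0 "v - w"] by simp
qed (use s v in blast)

text \<open>Scalar integrability comes with a sequence of simple functions converging in mean; a
  member with mean error below \<epsilon> also has its integral within \<epsilon>.\<close>

lemma integrable_simple_approx:
  fixes c :: "'a \<Rightarrow> real"
  assumes c: "integrable M c" and \<epsilon>: "\<epsilon> > 0"
  obtains \<sigma> where "Bochner_Integration.simple_bochner_integrable M \<sigma>" "(\<integral>\<^sup>+x. ennreal \<bar>\<sigma> x - c x\<bar> \<partial>M) < ennreal \<epsilon>"
    "\<bar>Bochner_Integration.simple_bochner_integral M \<sigma> - integral\<^sup>L M c\<bar> \<le> \<epsilon>"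
proof -
  obtain s where s: "\<And>i. Bochner_Integration.simple_bochner_integrable M (s i)"
    "(\<lambda>i. \<integral>\<^sup>+x. ennreal (norm (c x - s i x)) \<partial>M) \<longlonglongrightarrow> 0"
    using c by (elim integrable.cases has_bochner_integral.cases) blast
  obtain i where i: "(\<integral>\<^sup>+x. ennreal (norm (c x - s i x)) \<partial>M) < ennreal \<epsilon>"
    using order_tendstoD(2)[OF s(2), of "ennreal \<epsilon>"] \<epsilon>
    by (auto simp: eventually_sequentially)
  have hbi: "has_bochner_integral M (s i) (Bochner_Integration.simple_bochner_integral M (s i))"
    by (rule has_bochner_integral_simple_bochner_integrable[OF s(1)])
  then have int: "integrable M (s i)"
    by (rule integrable.intros)
  have bound: "(\<integral>\<^sup>+x. ennreal \<bar>s i x - c x\<bar> \<partial>M) < ennreal \<epsilon>"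
    using i by (simp add: abs_minus_commute)
  have "Bochner_Integration.simple_bochner_integral M (s i) - integral\<^sup>L M c = (\<integral>x. s i x - c x \<partial>M)"
    using hbi int c by (simp add: has_bochner_integral_integral_eq)
  moreover have "ennreal (norm (\<integral>x. s i x - c x \<partial>M)) \<le> (\<integral>\<^sup>+x. ennreal (norm (s i x - c x)) \<partial>M)"
    using int c by (intro integral_norm_bound_ennreal) auto
  ultimately have "ennreal \<bar>Bochner_Integration.simple_bochner_integral M (s i) - integral\<^sup>L M c\<bar> < ennreal \<epsilon>"
    using bound by (simp add: order.strict_trans1)
  then have "\<bar>Bochner_Integration.simple_bochner_integral M (s i) - integral\<^sup>L M c\<bar> \<le> \<epsilon>"
    by (simp add: ennreal_less_iff)
  then show ?thesis using that s(1) bound by blast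
qed

text \<open>Each scalar coefficient is approximated separately. The majorant \<open>r\<close> is
  built from real functions alone, so its measurability does not involve the space
  \<open>'b\<close>.\<close>

lemma finite_combination_simple_approx:
  fixes c :: "'k \<Rightarrow> 'a \<Rightarrow> real" and a :: "'k \<Rightarrow> 'b::real_normed_vector"
  assumes c: "\<And>k. k \<in> K \<Longrightarrow> integrable M (c k)" and \<epsilon>: "\<epsilon> > 0"
  shows "\<exists>s r. Bochner_Integration.simple_bochner_integrable M s \<and> r \<in> borel_measurable M \<and>
    (\<forall>x. ennreal (norm (s x - (\<Sum>k\<in>K. c k x *\<^sub>R a k))) \<le> r x) \<and>
    (\<integral>\<^sup>+x. r x \<partial>M) \<le> ennreal \<epsilon> \<and>
    norm (Bochner_Integration.simple_bochner_integral M s - (\<Sum>k\<in>K. integral\<^sup>L M (c k) *\<^sub>R a k)) \<le> \<epsilon>"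
proof -
  \<comment> \<open>The summand 1 keeps \<open>A\<close> positive when all the vectors vanish.
    Coefficient errors of \<open>\<epsilon> / A\<close> then add up to at most \<epsilon>.\<close>
  define A where "A = 1 + (\<Sum>k\<in>K. norm (a k))"
  have A: "A > 0"
    unfolding A_def by (intro add_pos_nonneg sum_nonneg) auto
  have sum_le: "(\<Sum>k\<in>K. \<epsilon> / A * norm (a k)) \<le> \<epsilon>"
  proof -
    have "(\<Sum>k\<in>K. \<epsilon> / A * norm (a k)) = \<epsilon> * ((A - 1) / A)"
      by (simp add: A_def sum_distrib_left sum_divide_distrib)
    also have "\<dots> \<le> \<epsilon> * 1"
      using A \<epsilon> by (intro mult_left_mono) auto
    finally show ?thesis by simp
  qed
  have "\<exists>\<sigma>. Bochner_Integration.simple_bochner_integrable M \<sigma> \<and> (\<integral>\<^sup>+x. ennreal \<bar>\<sigma> x - c k x\<bar> \<partial>M) \<le> ennreal (\<epsilon> / A) \<and>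
      \<bar>Bochner_Integration.simple_bochner_integral M \<sigma> - integral\<^sup>L M (c k)\<bar> \<le> \<epsilon> / A" if "k \<in> K" for k
    using integrable_simple_approx[OF c[OF that], of "\<epsilon> / A"] A \<epsilon>
    by (metis divide_pos_pos less_imp_le)
  then obtain \<sigma> where \<sigma>: "\<And>k. k \<in> K \<Longrightarrow> Bochner_Integration.simple_bochner_integrable M (\<sigma> k)"
    "\<And>k. k \<in> K \<Longrightarrow> (\<integral>\<^sup>+x. ennreal \<bar>\<sigma> k x - c k x\<bar> \<partial>M) \<le> ennreal (\<epsilon> / A)"
    "\<And>k. k \<in> K \<Longrightarrow> \<bar>Bochner_Integration.simple_bochner_integral M (\<sigma> k) - integral\<^sup>L M (c k)\<bar> \<le> \<epsilon> / A"
    by metis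
  have \<sigma>_meas: "\<sigma> k \<in> borel_measurable M" if "k \<in> K" for k
    using \<sigma>(1)[OF that]
    by (auto intro: borel_measurable_simple_function elim: simple_bochner_integrable.cases)
  define s where "s x = (\<Sum>k\<in>K. \<sigma> k x *\<^sub>R a k)" for x
  define r where "r x = (\<Sum>k\<in>K. ennreal \<bar>\<sigma> k x - c k x\<bar> * ennreal (norm (a k)))" for x
  have term_meas: "(\<lambda>x. ennreal \<bar>\<sigma> k x - c k x\<bar>) \<in> borel_measurable M" if "k \<in> K" for k
    using \<sigma>_meas[OF that] c[OF that] by measurable
  have s: "Bochner_Integration.simple_bochner_integrable M s"
    unfolding s_def by (intro simple_bochner_integrable_sum simple_bochner_integrable_scaleR \<sigma>(1))
  have r: "r \<in> borel_measurable M"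
    unfolding r_def[abs_def] by (intro borel_measurable_sum borel_measurable_times_ennreal term_meas) auto
  have "ennreal (norm (s x - (\<Sum>k\<in>K. c k x *\<^sub>R a k))) \<le> r x" for x
  proof -
    have "s x - (\<Sum>k\<in>K. c k x *\<^sub>R a k) = (\<Sum>k\<in>K. (\<sigma> k x - c k x) *\<^sub>R a k)"
      by (simp add: s_def scaleR_left_diff_distrib sum_subtractf)
    also have "norm \<dots> \<le> (\<Sum>k\<in>K. norm ((\<sigma> k x - c k x) *\<^sub>R a k))"
      by (rule norm_sum)
    also have "\<dots> = (\<Sum>k\<in>K. \<bar>\<sigma> k x - c k x\<bar> * norm (a k))"
      by simp
    finally have "ennreal (norm (s x - (\<Sum>k\<in>K. c k x *\<^sub>R a k)))
        \<le> ennreal (\<Sum>k\<in>K. \<bar>\<sigma> k x - c k x\<bar> * norm (a k))"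
      by (rule ennreal_leI)
    also have "\<dots> = r x"
      by (subst sum_ennreal[symmetric]) (auto simp: r_def ennreal_mult)
    finally show ?thesis .
  qed
  moreover have "(\<integral>\<^sup>+x. r x \<partial>M) \<le> ennreal \<epsilon>"
  proof -
    have "(\<integral>\<^sup>+x. r x \<partial>M) = (\<Sum>k\<in>K. (\<integral>\<^sup>+x. ennreal \<bar>\<sigma> k x - c k x\<bar> \<partial>M) * ennreal (norm (a k)))"
      unfolding r_def using term_meas by (simp add: nn_integral_sum nn_integral_multc)
    also have "\<dots> \<le> (\<Sum>k\<in>K. ennreal (\<epsilon> / A) * ennreal (norm (a k)))"
      by (intro sum_mono mult_right_mono \<sigma>(2)) auto
    also have "\<dots> = ennreal (\<Sum>k\<in>K. \<epsilon> / A * norm (a k))"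
      using A \<epsilon> by (simp flip: ennreal_mult)
    also have "\<dots> \<le> ennreal \<epsilon>"
      using sum_le by (rule ennreal_leI)
    finally show ?thesis .
  qed
  moreover have "norm (Bochner_Integration.simple_bochner_integral M s - (\<Sum>k\<in>K. integral\<^sup>L M (c k) *\<^sub>R a k)) \<le> \<epsilon>"
  proof -
    have "Bochner_Integration.simple_bochner_integral M s = (\<Sum>k\<in>K. Bochner_Integration.simple_bochner_integral M (\<lambda>x. \<sigma> k x *\<^sub>R a k))"
      unfolding s_def by (intro simple_bochner_integral_sum simple_bochner_integrable_scaleR \<sigma>(1))
    also have "\<dots> = (\<Sum>k\<in>K. Bochner_Integration.simple_bochner_integral M (\<sigma> k) *\<^sub>R a k)"
      by (intro sum.cong refl simple_bochner_integral_linear[OF linear_scaleR_left] \<sigma>(1))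
    finally have "Bochner_Integration.simple_bochner_integral M s - (\<Sum>k\<in>K. integral\<^sup>L M (c k) *\<^sub>R a k)
        = (\<Sum>k\<in>K. (Bochner_Integration.simple_bochner_integral M (\<sigma> k) - integral\<^sup>L M (c k)) *\<^sub>R a k)"
      by (simp add: scaleR_left_diff_distrib sum_subtractf)
    also have "norm \<dots> \<le> (\<Sum>k\<in>K. \<epsilon> / A * norm (a k))"
      by (intro order_trans[OF norm_sum] sum_mono) (metis \<sigma>(3) mult_right_mono norm_ge_zero norm_scaleR real_norm_def)
    finally show ?thesis using sum_le by linarith
  qed
  ultimately show ?thesis using s r by blast
qed

text \<open>Replacing the coefficients by simple functions costs an error \<open>r j\<close> with
  integral at most \<open>(1/2) ^ j\<close>, so the resulting simple functions stay within
  \<open>r j + d j\<close> of \<open>g\<close>. The measurable majorant \<open>d\<close> stands in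
  for the distance to \<open>g\<close>.\<close>

lemma bochner_approx_from_finite_combinations:
  fixes c :: "nat \<Rightarrow> 'k \<Rightarrow> 'a \<Rightarrow> real" and g :: "'a \<Rightarrow> 'b::real_normed_vector"
  assumes c: "\<And>j k. k \<in> K j \<Longrightarrow> integrable M (c j k)"
    and d: "\<And>j. d j \<in> borel_measurable M"
    and le: "\<And>j x. x \<in> space M \<Longrightarrow> ennreal (norm ((\<Sum>k\<in>K j. c j k x *\<^sub>R a j k) - g x)) \<le> d j x"
    and lim: "\<And>x. x \<in> space M \<Longrightarrow> (\<lambda>j. d j x) \<longlonglongrightarrow> 0"
    and lim_int: "(\<lambda>j. \<integral>\<^sup>+x. d j x \<partial>M) \<longlonglongrightarrow> 0"
    and v: "(\<lambda>j. \<Sum>k\<in>K j. integral\<^sup>L M (c j k) *\<^sub>R a j k) \<longlonglongrightarrow> v"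
  shows "bochner_integrable M g" and "bochner_integral M g = v"
proof -
  define C where "C j x = (\<Sum>k\<in>K j. c j k x *\<^sub>R a j k)" for j x
  define V where "V j = (\<Sum>k\<in>K j. integral\<^sup>L M (c j k) *\<^sub>R a j k)" for j
  have "\<forall>j. \<exists>s r. Bochner_Integration.simple_bochner_integrable M s \<and> r \<in> borel_measurable M \<and>
      (\<forall>x. ennreal (norm (s x - C j x)) \<le> r x) \<and> (\<integral>\<^sup>+x. r x \<partial>M) \<le> ennreal ((1/2) ^ j) \<and>
      norm (Bochner_Integration.simple_bochner_integral M s - V j) \<le> (1/2) ^ j"
    unfolding C_def V_def by (intro allI finite_combination_simple_approx c) auto
  then obtain s r where s: "\<And>j. Bochner_Integration.simple_bochner_integrable M (s j)"
    and r: "\<And>j. r j \<in> borel_measurable M"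
    and s_le: "\<And>j x. ennreal (norm (s j x - C j x)) \<le> r j x"
    and r_int: "\<And>j. (\<integral>\<^sup>+x. r j x \<partial>M) \<le> ennreal ((1/2) ^ j)"
    and s_int: "\<And>j. norm (Bochner_Integration.simple_bochner_integral M (s j) - V j) \<le> (1/2) ^ j"
    by metis
  have pow_lim: "(\<lambda>j. (1/2) ^ j :: real) \<longlonglongrightarrow> 0"
    by (intro LIMSEQ_realpow_zero) auto
  have bound: "ennreal (norm (s j x - g x)) \<le> r j x + d j x" if "x \<in> space M" for j x
  proof -
    have "norm (s j x - g x) \<le> norm (s j x - C j x) + norm (C j x - g x)"
      by (metis norm_diff_triangle_le order_refl)
    then have "ennreal (norm (s j x - g x)) \<le> ennreal (norm (s j x - C j x)) + ennreal (norm (C j x - g x))"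
      by (simp add: ennreal_leI flip: ennreal_plus)
    also have "\<dots> \<le> r j x + d j x"
      using s_le le[OF that] by (intro add_mono) (auto simp: C_def)
    finally show ?thesis .
  qed
  (* Errors summing to a finite integral tend to zero almost everywhere, so no subsequence
     of the simple functions has to be chosen. *)
  have r_lim: "AE x in M. (\<lambda>j. r j x) \<longlonglongrightarrow> 0"
  proof -
    have "(\<integral>\<^sup>+x. (\<Sum>j. r j x) \<partial>M) = (\<Sum>j. \<integral>\<^sup>+x. r j x \<partial>M)"
      by (intro nn_integral_suminf r)
    also have "\<dots> \<le> (\<Sum>j. ennreal ((1/2) ^ j))"
      by (intro suminf_le r_int) auto
    also have "\<dots> < \<infinity>"
      by (simp add: ennreal_suminf_neq_top summable_geometric flip: less_top)
    finally have "(\<integral>\<^sup>+x. (\<Sum>j. r j x) \<partial>M) \<noteq> \<infinity>"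
      by simp
    then have "AE x in M. (\<Sum>j. r j x) \<noteq> \<infinity>"
      by (intro nn_integral_PInf_AE) (use r in measurable)
    then show ?thesis
    proof eventually_elim
      case (elim x)
      \<comment> \<open>A finite sum has finite terms, which permits passing to real numbers, where
        the terms of a summable series tend to zero.\<close>
      have fin: "r j x < top" for j
        using elim sum_le_suminf[of "\<lambda>j. r j x" "{j}"]
        by (simp add: less_top order.strict_trans1)
      then have eq: "r j x = ennreal (enn2real (r j x))" for j
        by simp
      have "summable (\<lambda>j. enn2real (r j x))"
        using elim by (intro summable_suminf_not_top) (auto simp flip: eq)
      then have "(\<lambda>j. ennreal (enn2real (r j x))) \<longlonglongrightarrow> ennreal 0"
        by (intro tendsto_ennrealI summable_LIMSEQ_zero)
      then show ?case by (simp flip: eq)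
    qed
  qed
  have approx: "bochner_approx M g s"
    unfolding bochner_approx_def
  proof (intro conjI allI s)
    show "AE x in M. (\<lambda>j. norm (s j x - g x)) \<longlonglongrightarrow> 0"
      using r_lim AE_space
    proof eventually_elim
      case (elim x)
      then have "(\<lambda>j. r j x + d j x) \<longlonglongrightarrow> 0"
        using tendsto_add[OF _ lim] by fastforce
      then have "(\<lambda>j. ennreal (norm (s j x - g x))) \<longlonglongrightarrow> 0"
        using ennreal_tendsto_zero_le[OF _ bound] elim by simp
      then show ?case
        by (simp add: ennreal_tendsto_0_iff)
    qed
    have "(\<lambda>j. \<integral>\<^sup>+x. r j x \<partial>M) \<longlonglongrightarrow> 0"
      using tendsto_ennrealI[OF pow_lim]
      by (intro ennreal_tendsto_zero_le[OF _ r_int]) simp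
    then have "(\<lambda>j. (\<integral>\<^sup>+x. r j x \<partial>M) + (\<integral>\<^sup>+x. d j x \<partial>M)) \<longlonglongrightarrow> 0"
      using tendsto_add[OF _ lim_int] by fastforce
    moreover have "(\<integral>\<^sup>+x. ennreal (norm (s j x - g x)) \<partial>M) \<le> (\<integral>\<^sup>+x. r j x \<partial>M) + (\<integral>\<^sup>+x. d j x \<partial>M)" for j
      by (subst nn_integral_add[symmetric]) (auto intro: nn_integral_mono bound r d)
    ultimately show "(\<lambda>j. \<integral>\<^sup>+x. ennreal (norm (s j x - g x)) \<partial>M) \<longlonglongrightarrow> 0"
      by (rule ennreal_tendsto_zero_le)
  qed
  then show "bochner_integrable M g"
    by (auto simp: bochner_integrable_def)
  have "(\<lambda>j. Bochner_Integration.simple_bochner_integral M (s j) - V j) \<longlonglongrightarrow> 0"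
    using s_int by (intro Lim_null_comparison[OF _ pow_lim]) auto
  then have "(\<lambda>j. Bochner_Integration.simple_bochner_integral M (s j) - V j + V j) \<longlonglongrightarrow> 0 + v"
    using v unfolding V_def by (rule tendsto_add)
  then show "bochner_integral M g = v"
    by (intro bochner_integral_eqI[OF approx]) simp
qed

subsection \<open>Interchanging the function calculus and the integral\<close>

theorem theorem3p1:
  fixes \<mu> :: "'w measure"
    and f :: "real ^ 'n \<Rightarrow> 'w \<Rightarrow> real"
    and F :: "real ^ 'n \<Rightarrow> real"
    and x :: "'x::banach_lattice ^ 'n"
    and \<Phi> :: "(real ^ 'n \<Rightarrow> real) \<Rightarrow> 'x"
  assumes "finite_measure \<mu>"
    and "\<And>\<omega>. \<omega> \<in> space \<mu> \<Longrightarrow> (\<lambda>s. f s \<omega>) \<in> Hn"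
    and "\<And>s. integrable \<mu> (\<lambda>\<omega>. f s \<omega>)"
    and "\<And>s. F s = (\<integral>\<omega>. f s \<omega> \<partial>\<mu>)"
    and "krivine_calculus x \<Phi>"
    and "continuous_on UNIV F"
    and "integrable \<mu> (\<lambda>\<omega>. SUP s\<in>sphere_inf. \<bar>f s \<omega>\<bar>)"
  shows "bochner_integrable \<mu> (\<lambda>\<omega>. \<Phi> (\<lambda>s. f s \<omega>)) \<and>
         \<Phi> F = bochner_integral \<mu> (\<lambda>\<omega>. \<Phi> (\<lambda>s. f s \<omega>))"
proof -
  note f_Hn = assms(2) and f_int = assms(3) and F_eq = assms(4)
  have hom: "lattice_hom_Hn \<Phi>"
    using assms(5) by (simp add: krivine_calculus_def)
  have F_Hn: "F \<in> Hn"
  proof -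
    have "F (c *\<^sub>R t) = c * F t" if "c \<ge> 0" for c t
    proof -
      have "(\<integral>\<omega>. f (c *\<^sub>R t) \<omega> \<partial>\<mu>) = (\<integral>\<omega>. c * f t \<omega> \<partial>\<mu>)"
        using HnD_scale[OF f_Hn that] by (intro Bochner_Integration.integral_cong) auto
      then show ?thesis by (simp add: F_eq)
    qed
    then show ?thesis
      using assms(6) by (simp add: Hn_def pos_homogeneous_def)
  qed
  define S where "S = sphere (0 :: real ^ 'n) 1"
  define M where "M \<omega> = (SUP s\<in>sphere_inf. \<bar>f s \<omega>\<bar>)" for \<omega>
  \<comment> \<open>Points of \<open>S\<close> have Euclidean norm 1, so the factor
    \<open>norm s\<close> in the bound by the supremum over \<open>sphere_inf\<close>
    disappears.\<close>
  have f_le: "\<bar>f s \<omega>\<bar> \<le> M \<omega>" if "\<omega> \<in> space \<mu>" "s \<in> S" for s \<omega>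
    using Hn_bound_from_sphere_inf[OF f_Hn[OF that(1)], of s] that(2) by (simp add: S_def M_def)

  \<comment> \<open>Finite rank approximation on the sphere\<close>
  have "\<exists>K \<phi>. finite K \<and> K \<subseteq> S \<and> (\<forall>s\<in>K. \<phi> s \<in> Hn) \<and> (\<forall>s t. 0 \<le> \<phi> s t) \<and>
      (\<forall>t. (\<Sum>s\<in>K. \<phi> s t) = norm t) \<and> (\<forall>s. \<forall>t\<in>S. \<phi> s t \<noteq> 0 \<longrightarrow> dist t s < inverse (real (Suc j)))"
    for j
    by (rule homogeneous_partition[of "inverse (real (Suc j))", where 'n = 'n])
      (auto simp: S_def intro!: exI)
  then obtain K :: "nat \<Rightarrow> (real ^ 'n) set" and \<phi> where
    K_fin: "\<And>j. finite (K j)" and K_S: "\<And>j. K j \<subseteq> S" and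
    \<phi>_Hn: "\<And>j s. s \<in> K j \<Longrightarrow> \<phi> j s \<in> Hn" and \<phi>_nonneg: "\<And>j s t. 0 \<le> \<phi> j s t" and
    \<phi>_sum: "\<And>j t. (\<Sum>s\<in>K j. \<phi> j s t) = norm t" and
    \<phi>_supp: "\<And>j s t. t \<in> S \<Longrightarrow> \<phi> j s t \<noteq> 0 \<Longrightarrow> dist t s < inverse (real (Suc j))"
    by metis
  define P where "P j G t = (\<Sum>s\<in>K j. G s * \<phi> j s t)" for j and G :: "real ^ 'n \<Rightarrow> real" and t
  have P_Hn: "P j G \<in> Hn" for j G
    unfolding P_def[abs_def] by (intro Hn_sum Hn_scale \<phi>_Hn)
  have \<Phi>_P: "\<Phi> (P j G) = (\<Sum>s\<in>K j. G s *\<^sub>R \<Phi> (\<phi> j s))" for j G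
    unfolding P_def[abs_def] by (rule lattice_hom_Hn_sum[OF hom \<phi>_Hn])
  \<comment> \<open>The weights at \<open>t\<close> vanish at nodes farther away than the mesh, so
    the local oscillation of \<open>G\<close> controls the error. It serves twice: with uniform
    continuity for convergence, and with the crude bound \<open>2 * M \<omega>\<close> for
    domination.\<close>
  have P_close: "\<bar>P j G t - G t\<bar> \<le> \<epsilon>"
    if "t \<in> S" "\<And>s. s \<in> S \<Longrightarrow> dist t s < inverse (real (Suc j)) \<Longrightarrow> \<bar>G s - G t\<bar> \<le> \<epsilon>"
    for j G t \<epsilon>
    unfolding P_def
  proof (rule partition_approximation)
    show "(\<Sum>s\<in>K j. \<phi> j s t) = 1"
      using that(1) \<phi>_sum by (simp add: S_def)
  qed (use that \<phi>_nonneg \<phi>_supp K_S in blast)+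
  have P_uniform: "\<forall>\<^sub>F j in sequentially. \<forall>t\<in>S. \<bar>P j G t - G t\<bar> \<le> \<epsilon>"
    if G: "G \<in> Hn" and \<epsilon>: "\<epsilon> > 0" for G \<epsilon>
  proof -
    have "uniformly_continuous_on S G"
      unfolding S_def
      by (intro compact_uniformly_continuous continuous_on_subset[OF HnD_continuous[OF G]]) auto
    then obtain d where d: "d > 0" "\<And>s t. s \<in> S \<Longrightarrow> t \<in> S \<Longrightarrow> dist s t < d \<Longrightarrow> dist (G s) (G t) < \<epsilon>"
      using \<epsilon> unfolding uniformly_continuous_on_def by metis
    have "\<forall>\<^sub>F j in sequentially. inverse (real (Suc j)) < d"
      using order_tendstoD(2)[OF LIMSEQ_inverse_real_of_nat d(1)] .
    then show ?thesis
    proof eventually_elim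
      case (elim j)
      show ?case
      proof (intro ballI P_close)
        show "\<bar>G s - G t\<bar> \<le> \<epsilon>" if "t \<in> S" "s \<in> S" "dist t s < inverse (real (Suc j))" for s t
          using d(2)[of s t] that elim by (simp add: dist_commute dist_real_def)
      qed
    qed
  qed

  \<comment> \<open>A measurable and dominated approximation error\<close>
  obtain D where D: "countable D" "D \<subseteq> S" "S \<subseteq> closure D"
    using separable[of S] by metis
  (* The supremum over a countable dense set is measurable in \<omega>, unlike a priori the one over S. *)
  define d where "d j \<omega> = (SUP t\<in>D. ennreal \<bar>P j (\<lambda>s. f s \<omega>) t - f t \<omega>\<bar>)" for j \<omega>
  have d_meas: "d j \<in> borel_measurable \<mu>" for j
  proof -
    have [measurable]: "f s \<in> borel_measurable \<mu>" for s
      using f_int by (rule borel_measurable_integrable)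
    show ?thesis
      unfolding d_def[abs_def] P_def using D(1) by (intro borel_measurable_SUP) auto
  qed
  have d_le: "d j \<omega> \<le> ennreal \<epsilon>"
    if "\<And>t. t \<in> S \<Longrightarrow> \<bar>P j (\<lambda>s. f s \<omega>) t - f t \<omega>\<bar> \<le> \<epsilon>" for j \<omega> \<epsilon>
    unfolding d_def using that D(2) by (intro SUP_least ennreal_leI) auto
  have d_le_M: "d j \<omega> \<le> ennreal (2 * M \<omega>)" if \<omega>: "\<omega> \<in> space \<mu>" for j \<omega>
  proof (intro d_le P_close)
    show "\<bar>f s \<omega> - f t \<omega>\<bar> \<le> 2 * M \<omega>" if "s \<in> S" "t \<in> S" for s t
      using f_le[OF \<omega> that(1)] f_le[OF \<omega> that(2)] by linarith
  qed
  \<comment> \<open>The error is continuous in \<open>t\<close>, so the set where the bound holds is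
    closed and contains the closure of \<open>D\<close>. The bound \<open>2 * M \<omega>\<close>
    makes \<open>d j \<omega>\<close> finite, so that \<open>enn2real\<close> loses nothing.\<close>
  have le_d: "\<bar>P j (\<lambda>s. f s \<omega>) t - f t \<omega>\<bar> \<le> enn2real (d j \<omega>)"
    if \<omega>: "\<omega> \<in> space \<mu>" and t: "t \<in> S" for j \<omega> t
  proof -
    have "d j \<omega> < top"
      using d_le_M[OF \<omega>] by (rule order.strict_trans1) simp
    then have D_le: "\<bar>P j (\<lambda>s. f s \<omega>) t - f t \<omega>\<bar> \<le> enn2real (d j \<omega>)" if "t \<in> D" for t
      using SUP_upper[OF that, of "\<lambda>t. ennreal \<bar>P j (\<lambda>s. f s \<omega>) t - f t \<omega>\<bar>"]
      by (metis abs_ge_zero d_def enn2real_ennreal enn2real_mono)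
    have "continuous_on UNIV (\<lambda>t. \<bar>P j (\<lambda>s. f s \<omega>) t - f t \<omega>\<bar>)"
      by (intro continuous_intros HnD_continuous P_Hn f_Hn \<omega>)
    then have "closed {t. \<bar>P j (\<lambda>s. f s \<omega>) t - f t \<omega>\<bar> \<le> enn2real (d j \<omega>)}"
      by (intro closed_Collect_le) auto
    then have "closure D \<subseteq> {t. \<bar>P j (\<lambda>s. f s \<omega>) t - f t \<omega>\<bar> \<le> enn2real (d j \<omega>)}"
      using D_le by (intro closure_minimal) auto
    then show ?thesis using t D(3) by blast
  qed
  have d_lim: "(\<lambda>j. d j \<omega>) \<longlonglongrightarrow> 0" if \<omega>: "\<omega> \<in> space \<mu>" for \<omega>
  proof (rule order_tendstoI)
    fix a :: ennreal assume "0 < a"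
    \<comment> \<open>As \<open>a\<close> may be infinite, a positive real below it is
      chosen.\<close>
    then obtain \<epsilon> where \<epsilon>: "0 < \<epsilon>" "ennreal \<epsilon> < a"
      by (metis dense ennreal_cases ennreal_less_zero_iff less_top order.strict_trans)
    have "\<forall>\<^sub>F j in sequentially. d j \<omega> \<le> ennreal \<epsilon>"
      using P_uniform[OF f_Hn[OF \<omega>] \<epsilon>(1)] by eventually_elim (auto intro: d_le)
    then show "\<forall>\<^sub>F j in sequentially. d j \<omega> < a"
      by eventually_elim (use \<epsilon>(2) in order)
  qed simp
  have d_int_lim: "(\<lambda>j. \<integral>\<^sup>+\<omega>. d j \<omega> \<partial>\<mu>) \<longlonglongrightarrow> 0"
  proof -
    have M: "integrable \<mu> (\<lambda>\<omega>. 2 * M \<omega>)"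
      using assms(7) by (simp add: M_def)
    then have "(\<integral>\<^sup>+\<omega>. ennreal (norm (2 * M \<omega>)) \<partial>\<mu>) < \<infinity>"
      by (simp only: integrable_iff_bounded)
    moreover have "(\<integral>\<^sup>+\<omega>. ennreal (2 * M \<omega>) \<partial>\<mu>) \<le> (\<integral>\<^sup>+\<omega>. ennreal (norm (2 * M \<omega>)) \<partial>\<mu>)"
      by (intro nn_integral_mono ennreal_leI) simp
    ultimately have M_fin: "(\<integral>\<^sup>+\<omega>. ennreal (2 * M \<omega>) \<partial>\<mu>) < \<infinity>"
      by (rule order.strict_trans1[rotated])
    have M_meas: "(\<lambda>\<omega>. ennreal (2 * M \<omega>)) \<in> borel_measurable \<mu>"
      using borel_measurable_integrable[OF M] by simp
    have "(\<lambda>j. \<integral>\<^sup>+\<omega>. d j \<omega> \<partial>\<mu>) \<longlonglongrightarrow> (\<integral>\<^sup>+\<omega>. 0 \<partial>\<mu>)"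
    proof (rule nn_integral_dominated_convergence[OF d_meas])
      show "(\<integral>\<^sup>+\<omega>. ennreal (2 * M \<omega>) \<partial>\<mu>) < \<infinity>" by (rule M_fin)
    qed (use d_le_M d_lim M_meas in auto)
    then show ?thesis by simp
  qed

  \<comment> \<open>Transfer to the Banach lattice\<close>
  define E where "E = norm (\<Phi> norm)"
  \<comment> \<open>By linearity the sum is \<Phi> applied to
    \<open>P j (\<lambda>s. f s \<omega>)\<close>, and \<Phi> has Lipschitz constant
    \<open>E\<close> with respect to the uniform error on \<open>S\<close>.\<close>
  have \<Phi>_close: "ennreal (norm ((\<Sum>s\<in>K j. f s \<omega> *\<^sub>R \<Phi> (\<phi> j s)) - \<Phi> (\<lambda>s. f s \<omega>))) \<le> ennreal E * d j \<omega>"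
    if \<omega>: "\<omega> \<in> space \<mu>" for j \<omega>
  proof -
    have "norm (\<Phi> (P j (\<lambda>s. f s \<omega>)) - \<Phi> (\<lambda>s. f s \<omega>)) \<le> enn2real (d j \<omega>) * E"
      unfolding E_def lattice_hom_Hn_diff[OF hom P_Hn f_Hn[OF \<omega>], symmetric]
      by (intro norm_lattice_hom_Hn_le[OF hom] Hn_diff P_Hn f_Hn \<omega> le_d) (auto simp: S_def)
    moreover have "d j \<omega> = ennreal (enn2real (d j \<omega>))"
      using d_le_M[OF \<omega>, of j] by (simp add: order.strict_trans1)
    ultimately show ?thesis
      unfolding \<Phi>_P by (metis E_def ennreal_leI ennreal_mult enn2real_nonneg mult.commute norm_ge_zero)
  qed
  \<comment> \<open>The continuity of \<open>F\<close> enters here, through its uniform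
    approximation by \<open>P j F\<close> on the sphere.\<close>
  have "(\<lambda>j. \<Phi> (P j F)) \<longlonglongrightarrow> \<Phi> F"
  proof (rule tendstoI)
    fix e :: real assume e: "e > 0"
    \<comment> \<open>The denominator is \<open>E + 1\<close> because \<open>E\<close> may be
      zero.\<close>
    define \<epsilon> where "\<epsilon> = e / (E + 1)"
    have E: "E \<ge> 0" by (simp add: E_def)
    have \<epsilon>: "\<epsilon> > 0" "\<epsilon> * E < e"
      using e E by (auto simp: \<epsilon>_def field_simps)
    show "\<forall>\<^sub>F j in sequentially. dist (\<Phi> (P j F)) (\<Phi> F) < e"
      using P_uniform[OF F_Hn \<epsilon>(1)]
    proof eventually_elim
      case (elim j)
      then have "norm (\<Phi> (P j F) - \<Phi> F) \<le> \<epsilon> * E"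
        unfolding E_def lattice_hom_Hn_diff[OF hom P_Hn F_Hn, symmetric] using \<epsilon>(1)
        by (intro norm_lattice_hom_Hn_le[OF hom] Hn_diff P_Hn F_Hn) (auto simp: S_def)
      then show ?case using \<epsilon>(2) by (simp add: dist_norm)
    qed
  qed
  \<comment> \<open>The interchange happens at finite rank: the coefficients \<open>F s\<close> of
    \<open>\<Phi> (P j F)\<close> are exactly the integrals of the coefficient functions
    \<open>f s\<close>.\<close>
  then have lim_F: "(\<lambda>j. \<Sum>s\<in>K j. (\<integral>\<omega>. f s \<omega> \<partial>\<mu>) *\<^sub>R \<Phi> (\<phi> j s)) \<longlonglongrightarrow> \<Phi> F"
    by (simp add: \<Phi>_P F_eq)
  have Ed_meas: "(\<lambda>\<omega>. ennreal E * d j \<omega>) \<in> borel_measurable \<mu>" for j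
    using d_meas by measurable
  have Ed_lim: "(\<lambda>j. ennreal E * d j \<omega>) \<longlonglongrightarrow> 0" if "\<omega> \<in> space \<mu>" for \<omega>
    using ennreal_tendsto_cmult[OF _ d_lim[OF that], of "ennreal E"] by simp
  have Ed_int_lim: "(\<lambda>j. \<integral>\<^sup>+\<omega>. ennreal E * d j \<omega> \<partial>\<mu>) \<longlonglongrightarrow> 0"
    using ennreal_tendsto_cmult[OF _ d_int_lim, of "ennreal E"] d_meas by (simp add: nn_integral_cmult)
  note limits = bochner_approx_from_finite_combinations[where c = "\<lambda>j. f" and K = K,
      OF f_int Ed_meas \<Phi>_close Ed_lim Ed_int_lim lim_F]
  show ?thesis
    using limits by simp
qed

end
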